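(* Let $N$ be a positive integer. Then $$\sum_{n=0}^{\lfloor N/2\rfloor}\frac{(q\sqrt{k},-q\sqrt{k},y,z,k^2q^{N}/(yz),q^{-N};q)_{2n}\,q^{2n}}{(\sqrt{k},-\sqrt{k},qk/y,qk/z,yzq^{1-N}/k,kq^{1+N};q)_{2n}}$$ $$=\frac{(1-k/y)(1-k/z)(1-kq^N)(1-kq^N/(yz))}{(1-k)(1-k/(yz))(1-kq^N/y)(1-kq^N/z)}\sum_{n=0}^{N}\frac{(y,z,k^2q^{N}/(yz),q^{-N};q)_{n}}{(k/y,k/z,kq^{N},yzq^{-N}/k;q)_{n}}(-1)^n,$$ and $$\sum_{n=0}^{\lfloor N/2\rfloor}\frac{(1-yq^{4n+1})(y,-\sqrt{y}\,q^{N+1},q^{-N};q)_{2n}\,q^{2n}}{(1-yq)(q^2,-\sqrt{y}\,q^{1-N},yq^{2+N};q)_{2n}}=\frac{(1-q)(1+\sqrt{y})}{(1-q^{N+1})(1+\sqrt{y}\,q^N)}\,\frac{(yq^2,-q;q)_N}{(q\sqrt{y},-1/\sqrt{y};q)_N}\,y^{-N/2}.$$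
   Context: For an integer $n\ge 0$, $(x;q)_n=\prod_{i=0}^{n-1}(1-xq^i)$ and $(x_1,\dots,x_m;q)_n=\prod_{j=1}^m(x_j;q)_n$. Here $q,k,y,z$ are nonzero complex numbers such that none of the denominators vanish; $\sqrt k$ and $\sqrt y$ are fixed square roots, and $y^{-N/2}=(\sqrt y)^{-N}$. *)

theory Defs
  imports Complex_Main
begin

definition qpoch :: "complex \<Rightarrow> complex \<Rightarrow> nat \<Rightarrow> complex" where
  "qpoch x q n = (\<Prod>i<n. 1 - x * q ^ i)"

definition qpochs :: "complex list \<Rightarrow> complex \<Rightarrow> nat \<Rightarrow> complex" where
  "qpochs xs q n = (\<Prod>x\<leftarrow>xs. qpoch x q n)"

end

theory Submission
  imports Defs
begin

text \<open>
  If $abcd = k^2$, the differences of $T_m = \prod_{x \in \{a,b,c,d\}} (x;q)_m / (k/x;q)_m$ are, up to a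
  constant factor, the very-well-poised terms
  $(1 - kq^{2m})\, q^m \prod_x (x;q)_m / (qk/x;q)_m$. Keeping only the even $m$, the telescoping
  differences combine to $-\sum_j (-1)^j T_j$; here $d = q^{-N}$ makes $T_{N+1}$ vanish.
  This is the first identity. For the second take $k = yq$ and $z = -q\sqrt y$: the alternating
  sum is then a terminating very-well-poised ${}_6\phi_5$ series with $a = y$, $b = \sqrt y$,
  $c = -\sqrt y\,q^{N+1}$, whose argument $aq^{N+1}/(bc)$ is $-1$.
  This needs more denominators to be nonzero (for instance $1 - yq^{N+1}$) than the identity itself,
  so it is applied for all but finitely many values of $\sqrt y$, and the others follow by
  continuity.
\<close>

section \<open>Elementary rules for q-shifted factorials\<close>

lemma qpoch_0 [simp]: "qpoch x q 0 = 1"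
  by (simp add: qpoch_def)

lemma qpoch_Suc: "qpoch x q (Suc n) = qpoch x q n * (1 - x * q ^ n)"
  by (simp add: qpoch_def)

lemma qpoch_Suc_shift: "qpoch x q (Suc n) = (1 - x) * qpoch (q * x) q n"
  unfolding qpoch_def by (subst prod.lessThan_Suc_shift) (simp add: mult_ac)

lemma qpoch_eq_0_iff: "qpoch x q n = 0 \<longleftrightarrow> (\<exists>i<n. x * q ^ i = 1)"
  by (auto simp: qpoch_def prod_zero_iff)

lemma qpochs_Nil [simp]: "qpochs [] q n = 1"
  and qpochs_Cons [simp]: "qpochs (x # xs) q n = qpoch x q n * qpochs xs q n"
  by (simp_all add: qpochs_def)

section \<open>Telescoping of balanced well-poised quotients\<close>

text \<open>Both products are quartics in \<open>x\<close> with constant term 1 and leading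
  coefficient $k^2$. Balance gives $ab = (k/c)(k/d)$ and its analogues, so the quadratic
  coefficients agree too. The third elementary symmetric function of either quadruple is
  \<open>k\<close> times the first one of the other, so the cubic difference is $-k$ times the
  linear one.\<close>

lemma balanced_quartic_difference:
  fixes a b c d k x :: complex
  assumes nz: "a \<noteq> 0" "b \<noteq> 0" "c \<noteq> 0" "d \<noteq> 0" and bal: "a * b * c * d = k\<^sup>2"
  shows "(1 - a*x) * (1 - b*x) * (1 - c*x) * (1 - d*x)
       - (1 - k*x/a) * (1 - k*x/b) * (1 - k*x/c) * (1 - k*x/d)
       = (k/a + k/b + k/c + k/d - a - b - c - d) * x * (1 - k * x\<^sup>2)"
proof -
  define A B C D where "A = k/a" and "B = k/b" and "C = k/c" and "D = k/d"
  have k: "a * A = k" "b * B = k" "c * C = k" "d * D = k"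
    using nz by (simp_all add: A_def B_def C_def D_def)
  have "k \<noteq> 0" using nz bal by auto
  \<comment> \<open>Here $uvwz = k^2 = (wW)(zZ)$, and $wz$ cancels.\<close>
  have cross: "u * v = W * Z" if "w * W = k" "z * Z = k" "u * v * (w * z) = k\<^sup>2" for u v w z W Z
  proof -
    have "(u * v) * (w * z) = (W * Z) * (w * z)"
      using that by (metis (no_types) mult.commute mult.left_commute power2_eq_square mult.assoc)
    moreover have "w * z \<noteq> 0" using that \<open>k \<noteq> 0\<close> by auto
    ultimately show ?thesis by simp
  qed
  have pairs: "a * b = C * D" "a * c = B * D" "a * d = B * C" "b * c = A * D" "b * d = A * C" "c * d = A * B"
    by (rule cross, (rule k)+, use bal in \<open>simp add: mult_ac\<close>)+
  have "(1 - a*x) * (1 - b*x) * (1 - c*x) * (1 - d*x) - (1 - A*x) * (1 - B*x) * (1 - C*x) * (1 - D*x)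
      = (A + B + C + D - a - b - c - d) * x * (1 - k * x\<^sup>2)"
  proof -
    have expand: "(1 - a*x) * (1 - b*x) * (1 - c*x) * (1 - d*x)
        = 1 - (a + b + c + d) * x + (a*b + a*c + a*d + b*c + b*d + c*d) * x^2
          - ((a*b)*c + (a*b)*d + (c*d)*a + (c*d)*b) * x^3 + (a*b)*(c*d) * x^4" for a b c d :: complex
      by algebra
    have e3: "(a*b)*c = k*D" "(a*b)*d = k*C" "(c*d)*a = k*B" "(c*d)*b = k*A"
      unfolding pairs(1,6) k[symmetric] using k by (simp_all add: mult_ac)
    have E3: "(A*B)*C = k*d" "(A*B)*D = k*c" "(C*D)*A = k*b" "(C*D)*B = k*a"
      unfolding pairs(1,6)[symmetric] k[symmetric] using k by (simp_all add: mult_ac)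
    show ?thesis
      unfolding expand unfolding e3 E3 unfolding pairs by algebra
  qed
  then show ?thesis by (simp add: A_def B_def C_def D_def)
qed

text \<open>Over the common denominator of index $m+1$, the difference has as numerator the
  difference of the two quartics at $x = q^m$. Splitting off the first factor of each
  $(k/a;q)_{m+1}$ rather than the last one turns that denominator into a constant times the product
  of the $(qk/a;q)_m$.\<close>

lemma well_poised_telescope:
  fixes a b c d k q :: complex
  assumes nz: "a \<noteq> 0" "b \<noteq> 0" "c \<noteq> 0" "d \<noteq> 0" and bal: "a * b * c * d = k\<^sup>2"
    and den: "qpochs [k/a, k/b, k/c, k/d] q (Suc m) \<noteq> 0"
  shows "qpochs [a,b,c,d] q (Suc m) / qpochs [k/a, k/b, k/c, k/d] q (Suc m)
       - qpochs [a,b,c,d] q m / qpochs [k/a, k/b, k/c, k/d] q m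
       = (k/a + k/b + k/c + k/d - a - b - c - d) / ((1 - k/a) * (1 - k/b) * (1 - k/c) * (1 - k/d))
         * ((1 - k * q ^ (2*m)) * qpochs [a,b,c,d] q m * q ^ m
            / qpochs [q*k/a, q*k/b, q*k/c, q*k/d] q m)"
proof -
  define M M' where "M = qpochs [k/a, k/b, k/c, k/d] q m" and "M' = qpochs [k/a, k/b, k/c, k/d] q (Suc m)"
  define g where "g = (1 - k*q^m/a) * (1 - k*q^m/b) * (1 - k*q^m/c) * (1 - k*q^m/d)"
  define h where "h = (1 - a*q^m) * (1 - b*q^m) * (1 - c*q^m) * (1 - d*q^m)"
  define A where "A = qpochs [a,b,c,d] q m"
  define e where "e = k/a + k/b + k/c + k/d - a - b - c - d"
  have M': "M' = M * g" by (simp add: M_def M'_def g_def qpoch_Suc mult_ac)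
  have M'2: "M' = (1 - k/a) * (1 - k/b) * (1 - k/c) * (1 - k/d) * qpochs [q*k/a, q*k/b, q*k/c, q*k/d] q m"
    by (simp add: M'_def qpoch_Suc_shift mult_ac)
  have "M' \<noteq> 0" using den by (simp add: M'_def)
  then have "M \<noteq> 0" "g \<noteq> 0" by (auto simp: M')
  have "qpochs [a,b,c,d] q (Suc m) = A * h" by (simp add: A_def h_def qpoch_Suc mult_ac)
  moreover have "A / M = A * g / M'" using \<open>g \<noteq> 0\<close> by (simp add: M')
  moreover have "h - g = e * q ^ m * (1 - k * q ^ (2*m))"
    using balanced_quartic_difference[OF nz bal, of "q^m"]
    by (simp add: h_def g_def e_def power_even_eq)
  ultimately have "qpochs [a,b,c,d] q (Suc m) / M' - A / M = A * (e * q ^ m * (1 - k * q ^ (2*m))) / M'"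
    by (metis (no_types) diff_divide_distrib right_diff_distrib)
  also have "\<dots> = e / ((1 - k/a) * (1 - k/b) * (1 - k/c) * (1 - k/d)) * ((1 - k * q ^ (2*m)) * A * q ^ m
            / qpochs [q*k/a, q*k/b, q*k/c, q*k/d] q m)"
    unfolding M'2 by (simp add: mult_ac)
  finally show ?thesis unfolding A_def M_def M'_def e_def .
qed

text \<open>The pairs $(2n, 2n+1)$ exhaust the indices up to \<open>N\<close> if \<open>N\<close> is
  odd. If \<open>N\<close> is even, the last pair reaches $N+1$, where \<open>T\<close>
  vanishes.\<close>

lemma sum_consecutive_pairs:
  fixes T :: "nat \<Rightarrow> complex"
  assumes "T (Suc N) = 0"
  shows "(\<Sum>n = 0..N div 2. T (Suc (2*n)) - T (2*n)) = - (\<Sum>j = 0..N. T j * (-1) ^ j)"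
proof -
  have *: "(\<Sum>n = 0..m. T (Suc (2*n)) - T (2*n)) = - (\<Sum>j = 0..Suc (2*m). T j * (-1) ^ j)" for m
    by (induction m) simp_all
  show ?thesis
  proof (cases "even N")
    case True
    then have "2 * (N div 2) = N" by simp
    with * [of "N div 2"] assms show ?thesis by simp
  next
    case False
    then have "Suc (2 * (N div 2)) = N" by (simp add: odd_two_times_div_two_succ)
    with * [of "N div 2"] show ?thesis by simp
  qed
qed

lemma qpoch_power_int_neg_eq_0:
  assumes "q \<noteq> 0" shows "qpoch (q powi (- int N)) q (Suc N) = 0"
  using assms by (simp add: qpoch_Suc power_int_minus)

lemma qpoch_sqrt_ratio:
  assumes "sk\<^sup>2 = k" and "1 - k \<noteq> 0" and "qpoch sk q m * qpoch (- sk) q m \<noteq> 0"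
  shows "qpoch (q * sk) q m * qpoch (- (q * sk)) q m / (qpoch sk q m * qpoch (- sk) q m) = (1 - k * q ^ (2*m)) / (1 - k)"
proof -
  have "qpoch sk q (Suc m) * qpoch (-sk) q (Suc m)
      = (1 - sk) * (1 + sk) * (qpoch (q * sk) q m * qpoch (- (q * sk)) q m)"
    by (simp add: qpoch_Suc_shift)
  moreover have "qpoch sk q (Suc m) * qpoch (-sk) q (Suc m)
      = qpoch sk q m * qpoch (-sk) q m * ((1 - sk * q^m) * (1 + sk * q^m))"
    by (simp add: qpoch_Suc)
  moreover have "(1 - sk) * (1 + sk) = 1 - k" "(1 - sk * q^m) * (1 + sk * q^m) = 1 - k * q ^ (2*m)"
    unfolding assms(1)[symmetric] mult_2 power_add by algebra+
  ultimately show ?thesis using assms(2,3) by (simp add: frac_eq_eq mult_ac)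
qed

section \<open>The first identity\<close>

lemma even_well_poised_sum:
  fixes q k y z sk :: complex and N :: nat
  assumes N: "N > 0" and nz: "q \<noteq> 0" "k \<noteq> 0" "y \<noteq> 0" "z \<noteq> 0" and sk: "sk\<^sup>2 = k"
    and den1: "\<And>n. n \<le> N div 2 \<Longrightarrow>
        qpochs [sk, - sk, q * k / y, q * k / z, y * z * q powi (1 - int N) / k, k * q ^ (1 + N)] q (2 * n) \<noteq> 0"
    and den2: "(1 - k) * (1 - k / (y * z)) * (1 - k * q ^ N / y) * (1 - k * q ^ N / z) \<noteq> 0"
    and den3: "\<And>n. n \<le> N \<Longrightarrow> qpochs [k / y, k / z, k * q ^ N, y * z * q powi (- int N) / k] q n \<noteq> 0"
  shows "(\<Sum>n = 0..N div 2.
        qpochs [q * sk, - q * sk, y, z, k\<^sup>2 * q ^ N / (y * z), q powi (- int N)] q (2 * n) * q ^ (2 * n) /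
        qpochs [sk, - sk, q * k / y, q * k / z, y * z * q powi (1 - int N) / k, k * q ^ (1 + N)] q (2 * n))
     = ((1 - k / y) * (1 - k / z) * (1 - k * q ^ N) * (1 - k * q ^ N / (y * z))) /
       ((1 - k) * (1 - k / (y * z)) * (1 - k * q ^ N / y) * (1 - k * q ^ N / z)) *
       (\<Sum>n = 0..N.
          qpochs [y, z, k\<^sup>2 * q ^ N / (y * z), q powi (- int N)] q n /
          qpochs [k / y, k / z, k * q ^ N, y * z * q powi (- int N) / k] q n * (- 1) ^ n)"
proof -
  define v where "v = q powi (- int N)"
  define w where "w = k\<^sup>2 * q ^ N / (y * z)"
  have vN: "q ^ N = 1 / v" and v0: "v \<noteq> 0" using nz by (simp_all add: v_def power_int_minus divide_simps)
  have w0: "w \<noteq> 0" using nz by (simp add: w_def)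
  have bal: "y * z * w * v = k\<^sup>2" using nz v0 by (simp add: w_def vN)
  have kv: "k / v = k * q ^ N" "q * k / v = k * q ^ (1 + N)"
    using nz v0 by (simp_all add: vN)
  have kw: "k / w = y * z * v / k" "q * k / w = q * (y * z * v / k)"
    using nz v0 by (simp_all add: w_def vN power2_eq_square)
  have qv: "y * z * q powi (1 - int N) / k = q * k / w"
    using nz by (simp add: kw v_def power_int_diff power_int_minus divide_simps)
  define T where "T j = qpochs [y, z, w, v] q j / qpochs [k/y, k/z, k/w, k/v] q j" for j
  define U where "U m = (1 - k * q ^ (2*m)) * qpochs [y,z,w,v] q m * q ^ m
            / qpochs [q*k/y, q*k/z, q*k/w, q*k/v] q m" for m
  define \<Pi> where "\<Pi> = (1 - k/y) * (1 - k/z) * (1 - k/w) * (1 - k/v)"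
  define e where "e = k/y + k/z + k/w + k/v - y - z - w - v"
  \<comment> \<open>\<Pi> is the denominator of index 1 on the right-hand side, an index in range
    because $N > 0$.\<close>
  have first: "\<Pi> \<noteq> 0"
    using den3[of 1] N by (simp add: \<Pi>_def kw kv qpoch_def flip: v_def)
  have tel: "T (Suc (2*n)) - T (2*n) = e / \<Pi> * U (2*n)" if "n \<le> N div 2" for n
    unfolding T_def U_def e_def \<Pi>_def
  proof (rule well_poised_telescope[OF nz(3,4) w0 v0 bal])
    show "qpochs [k/y, k/z, k/w, k/v] q (Suc (2*n)) \<noteq> 0"
      using den1[OF that] first unfolding qv kv[symmetric]
      by (simp add: qpoch_Suc_shift \<Pi>_def)
  qed
  have TN: "T (Suc N) = 0"
    by (simp add: T_def v_def qpoch_power_int_neg_eq_0[OF nz(1)])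
  have summand: "qpochs [q * sk, - q * sk, y, z, w, v] q (2 * n) * q ^ (2 * n) /
        qpochs [sk, - sk, q * k / y, q * k / z, q * k / w, q * k / v] q (2 * n) = U (2*n) / (1 - k)"
    if "n \<le> N div 2" for n
  proof -
    have "qpoch sk q (2*n) * qpoch (- sk) q (2*n) \<noteq> 0"
      using den1[OF that] by simp
    from qpoch_sqrt_ratio[OF sk _ this] den2
    have "qpoch (q * sk) q (2*n) * qpoch (- (q * sk)) q (2*n) / (qpoch sk q (2*n) * qpoch (- sk) q (2*n)) = (1 - k * q ^ (2*(2*n))) / (1 - k)"
      by simp
    then have "qpoch (q * sk) q (2*n) * qpoch (- (q * sk)) q (2*n) / (qpoch sk q (2*n) * qpoch (- sk) q (2*n)) * Z = (1 - k * q ^ (2*(2*n))) / (1 - k) * Z" for Z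
      by simp
    from this[of "qpochs [y,z,w,v] q (2*n) * q ^ (2*n) / qpochs [q*k/y, q*k/z, q*k/w, q*k/v] q (2*n)"]
    show ?thesis by (simp add: U_def mult_ac)
  qed
  \<comment> \<open>Since $k/w = yzv/k$ and $w = k^2/(yzv)$, the right-hand product expands to
    exactly the eight terms of \<open>e\<close>. Its factors are the ones that \<open>den2\<close>
    keeps nonzero.\<close>
  have e: "e = (y * z * v / k) * ((1 - k / (y * z)) * (1 - k / v / y) * (1 - k / v / z))"
    using nz v0 unfolding e_def kw unfolding w_def vN
    by (simp add: field_simps power2_eq_square)
  have e0: "e \<noteq> 0" using den2 nz v0 unfolding e kv by simp
  \<comment> \<open>The factor $yzv/k$ cancels the one in \<open>e\<close>; the minus sign will
    cancel the one from pairing consecutive terms.\<close>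
  have "(1 - k/w) = - (y * z * v / k) * (1 - k / v / (y * z))"
    using nz v0 by (simp add: kw field_simps)
  then have pre: "\<Pi> / ((1 - k) * e) = - (((1 - k / y) * (1 - k / z) * (1 - k / v) * (1 - k / v / (y * z))) /
       ((1 - k) * (1 - k / (y * z)) * (1 - k / v / y) * (1 - k / v / z)))"
    unfolding \<Pi>_def e using nz v0 by (simp add: mult_ac)
  have "(\<Sum>n = 0..N div 2. U (2*n) / (1 - k)) = (\<Sum>n = 0..N div 2. \<Pi> / ((1 - k) * e) * (T (Suc (2*n)) - T (2*n)))"
    using e0 first by (intro sum.cong) (auto simp: tel)
  also have "\<dots> = \<Pi> / ((1 - k) * e) * - (\<Sum>j = 0..N. T j * (-1) ^ j)"
    by (simp only: sum_consecutive_pairs[of T, OF TN] sum_distrib_left[symmetric])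
  also have "\<dots> = ((1 - k / y) * (1 - k / z) * (1 - k / v) * (1 - k / v / (y * z))) /
       ((1 - k) * (1 - k / (y * z)) * (1 - k / v / y) * (1 - k / v / z)) * (\<Sum>j = 0..N. T j * (-1) ^ j)"
    unfolding pre by simp
  also have "(\<Sum>j = 0..N. T j * (-1) ^ j) = (\<Sum>j = 0..N. qpochs [y, z, w, v] q j / qpochs [k/y, k/z, k/v, k/w] q j * (-1) ^ j)"
    by (simp add: T_def mult_ac)
  finally show ?thesis
    using summand unfolding qv kv(2)[symmetric] kv(1)[symmetric] w_def[symmetric] v_def[symmetric] kw(1)[symmetric]
    by simp
qed

section \<open>Summation of the terminating very-well-poised 6-phi-5 series\<close>

lemma terminating_6phi5:
  fixes a b c q :: complex
  assumes nz: "a \<noteq> 0" "b \<noteq> 0" "c \<noteq> 0" "q \<noteq> 0"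
    and "\<And>j. 1 \<le> j \<Longrightarrow> j \<le> N \<Longrightarrow> q ^ j \<noteq> 1 \<and> a * q ^ j / b \<noteq> 1 \<and> a * q ^ j / c \<noteq> 1"
    and "\<And>j. 1 \<le> j \<Longrightarrow> j \<le> 2 * N \<Longrightarrow> a * q ^ j \<noteq> 1"
  shows "(\<Sum>n = 0..N. (1 - a * q ^ (2*n)) * qpochs [a, b, c, 1 / q ^ N] q n * (a * q ^ (N+1) / (b*c)) ^ n
            / qpochs [q, a*q/b, a*q/c, a * q ^ (N+1)] q n)
       = (1 - a) * (qpochs [a*q, a*q/(b*c)] q N / qpochs [a*q/b, a*q/c] q N)"
  using assms(5,6)
proof (induction N)
  case 0
  then show ?case by simp
next
  case (Suc N)
  define P where "P = q ^ Suc N"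
  have P0: "P \<noteq> 0" using nz by (simp add: P_def)
  define t where "t N n = (1 - a * q ^ (2*n)) * qpochs [a, b, c, 1 / q ^ N] q n * (a * q ^ (N+1) / (b*c)) ^ n
            / qpochs [q, a*q/b, a*q/c, a * q ^ (N+1)] q n" for N n
  \<comment> \<open>A common kernel of \<open>t (Suc N) n\<close> and \<open>t N n\<close>: the
    factorial $(aP;q)_{n+1}$ contains both $(aP;q)_n$ and $(aqP;q)_n$, so each term is
    \<open>D n\<close> times a polynomial in $q^n$.\<close>
  define D where "D n = qpochs [a, b, c, 1 / P] q n * (a * P / (b*c)) ^ n
            / (qpochs [q, a*q/b, a*q/c] q n * qpoch (a * P) q (Suc n))" for n
  \<comment> \<open>The ratio of \<open>D (Suc n)\<close> to \<open>D n\<close> is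
    $-L(q^n)/M(q^{n+1})$. The telescoping starts properly because $M(1) = 0$.\<close>
  define L where "L x = (a/(b*c)) * (1 - a*x) * (1 - b*x) * (1 - c*x) * (x - P)" for x
  define M where "M x = (1 - x) * (1 - a*x/b) * (1 - a*x/c) * (1 - a*P*x)" for x
  \<comment> \<open>The ratio of the closed forms for $N+1$ and \<open>N\<close>.\<close>
  define \<rho> where "\<rho> = (1 - a*P) * (1 - a*P/(b*c)) / ((1 - a*P/b) * (1 - a*P/c))"
  have n1: "1 - P \<noteq> 0" "1 - a*P/b \<noteq> 0" "1 - a*P/c \<noteq> 0"
    using Suc.prems(1)[of "Suc N"] by (auto simp: P_def)
  have n2: "1 - a * P * q ^ j \<noteq> 0" if "j \<le> Suc N" for j
    using Suc.prems(2)[of "Suc N + j"] that by (simp add: P_def power_add mult_ac)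
  text \<open>Wilf--Zeilberger certificate: the terms $D_n (L(q^n) + M(q^n))$ telescope, and
    $L(P) = 0$ ends the sum at $n = N + 1$.\<close>
  have D_Suc: "D (Suc n) * M (q ^ Suc n) = - (D n * L (q ^ n))" if "n < Suc N" for n
  proof -
    have nn: "1 - q ^ Suc n \<noteq> 0" "1 - a * q ^ Suc n / b \<noteq> 0" "1 - a * q ^ Suc n / c \<noteq> 0"
      "1 - a * P * q ^ Suc n \<noteq> 0"
      using Suc.prems(1)[of "Suc n"] n2[of "Suc n"] that by auto
    have den: "qpochs [q, a*q/b, a*q/c] q (Suc n) * qpoch (a * P) q (Suc (Suc n))
       = qpochs [q, a*q/b, a*q/c] q n * qpoch (a * P) q (Suc n) * M (q ^ Suc n)"
      by (simp add: qpoch_Suc M_def mult_ac)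
    have num: "qpochs [a, b, c, 1 / P] q (Suc n) * (a * P / (b*c)) ^ Suc n
       = qpochs [a, b, c, 1 / P] q n * (a * P / (b*c)) ^ n * - L (q ^ n)"
    proof -
      have "(1 - 1 / P * q ^ n) * (a * P / (b*c)) = - (a / (b*c)) * (q ^ n - P)"
        using P0 nz by (simp add: field_simps)
      then have "(1 - a * q^n) * (1 - b*q^n) * (1 - c * q^n) * ((1 - 1 / P * q ^ n) * (a * P / (b*c))) = - L (q ^ n)"
        by (simp add: L_def)
      then have "Z * ((1 - a * q^n) * (1 - b*q^n) * (1 - c * q^n) * ((1 - 1 / P * q ^ n) * (a * P / (b*c)))) = Z * - L (q ^ n)" for Z
        by simp
      from this[of "qpochs [a, b, c, 1 / P] q n * (a * P / (b*c)) ^ n"]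
      show ?thesis unfolding qpochs_Cons qpochs_Nil qpoch_Suc power_Suc by (simp only: mult_ac mult_1_right mult_1_left)
    qed
    have "M (q ^ Suc n) \<noteq> 0" using nn by (simp add: M_def)
    then show ?thesis unfolding D_def num den by simp
  qed
  have partial: "(\<Sum>n = 0..m. D n * (L (q ^ n) + M (q ^ n))) = D m * L (q ^ m)" if "m \<le> Suc N" for m
    using that
  proof (induction m)
    case 0
    then show ?case by (simp add: M_def)
  next
    case (Suc m)
    then show ?case using D_Suc[of m] by (simp add: distrib_left)
  qed
  define K where "K = P * (1 - a*P) / ((1 - P) * (1 - a*P/b) * (1 - a*P/c))"
  have t_diff: "t (Suc N) n - \<rho> * t N n = K * (D n * (L (q ^ n) + M (q ^ n)))" if "n \<le> Suc N" for n
  proof -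
    define x where "x = q ^ n"
    define W where "W = 1 - a*P"
    have W0: "W \<noteq> 0" using n2[of 0] by (simp add: W_def)
    have x2: "q ^ (2*n) = x\<^sup>2" by (simp add: x_def power_even_eq)
    have "qpoch (1/P) q (Suc n) = qpoch (1/P) q n * (1 - x/P)" by (simp add: qpoch_Suc x_def)
    moreover have "qpoch (1/P) q (Suc n) = (1 - 1/P) * qpoch (1 / q^N) q n"
      using nz by (simp add: qpoch_Suc_shift P_def)
    ultimately have sh1: "qpoch (1 / q^N) q n = qpoch (1/P) q n * ((x - P) / (1 - P))"
      using n1(1) P0 by (simp add: field_simps)
    have sh2: "qpoch (a * P) q (Suc n) = W * qpoch (a * q ^ (Suc N + 1)) q n"
      by (simp add: qpoch_Suc_shift P_def W_def mult_ac)
    have sh3: "qpoch (a * P) q (Suc n) = qpoch (a * P) q n * (1 - a*P*x)"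
      by (simp add: qpoch_Suc x_def)
    have aPx: "1 - a*P*x \<noteq> 0" using n2[OF that] by (simp add: x_def)
    have t1: "t (Suc N) n = D n * ((1 - a*x\<^sup>2) * x * W)"
    proof -
      have "(a * q ^ (Suc N + 1) / (b*c)) ^ n = (a * P / (b*c)) ^ n * x"
        by (simp add: P_def x_def power_mult_distrib power_divide mult_ac)
      then show ?thesis
        using W0 unfolding t_def D_def sh2 x2 by (simp add: P_def mult_ac)
    qed
    have t2: "t N n = D n * ((1 - a*x\<^sup>2) * ((x - P) / (1 - P)) * (1 - a*P*x))"
      using aPx unfolding t_def D_def sh3 x2 by (simp add: sh1 mult_ac) (simp add: P_def mult_ac)
    have key: "x * (1-P) * ((1 - a*P/b) * (1 - a*P/c)) * (1 - a*x\<^sup>2) - (x - P) * (1 - a*P*x) * (1 - a*P/(b*c)) * (1 - a*x\<^sup>2)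
        = P * (L x + M x)"
    proof -
      \<comment> \<open>Naming the inverses makes the claim a polynomial identity modulo $b\<beta> =
        1$ and $c\<gamma> = 1$.\<close>
      define \<beta> \<gamma> where "\<beta> = 1/b" and "\<gamma> = 1/c"
      have [simp]: "b * \<beta> = 1" "c * \<gamma> = 1" using nz by (simp_all add: \<beta>_def \<gamma>_def)
      have L: "L x = a * \<beta> * \<gamma> * (1 - a*x) * (1 - b*x) * (1 - c*x) * (x - P)"
        by (simp add: L_def \<beta>_def \<gamma>_def)
      have M: "M x = (1 - x) * (1 - a*\<beta>*x) * (1 - a*\<gamma>*x) * (1 - a*P*x)"
        by (simp add: M_def \<beta>_def \<gamma>_def)
      have "x * (1-P) * ((1 - a*P*\<beta>) * (1 - a*P*\<gamma>)) * (1 - a*x\<^sup>2) - (x - P) * (1 - a*P*x) * (1 - a*P*\<beta>*\<gamma>) * (1 - a*x\<^sup>2)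
        = P * (L x + M x)"
        unfolding L M using \<open>b * \<beta> = 1\<close> \<open>c * \<gamma> = 1\<close> by algebra
      then show ?thesis by (simp add: \<beta>_def \<gamma>_def)
    qed
    define u where "u = (1 - a*P/b) * (1 - a*P/c)"
    have u0: "u \<noteq> 0" using n1 by (simp add: u_def)
    have "t (Suc N) n - \<rho> * t N n = D n * W / ((1 - P) * u) *
       (x * (1-P) * u * (1 - a*x\<^sup>2) - (x - P) * (1 - a*P*x) * (1 - a*P/(b*c)) * (1 - a*x\<^sup>2))"
    proof -
      have r: "\<rho> = W * (1 - a*P/(b*c)) / u" by (simp add: \<rho>_def W_def u_def)
      have "d * (s * x * W) - W * R / u * (d * (s * (p / v) * m)) = d * W / (v * u) * (x * v * u * s - p * m * R * s)"
        if "v \<noteq> 0" for d s R p v m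
        using that u0 by (simp add: field_simps)
      from this[OF n1(1)] show ?thesis unfolding t1 t2 r by blast
    qed
    also have "\<dots> = K * (D n * (L x + M x))"
      unfolding u_def key by (simp add: K_def W_def mult_ac)
    finally show ?thesis by (simp add: x_def)
  qed
  have "(\<Sum>n = 0..Suc N. t (Suc N) n - \<rho> * t N n) = (\<Sum>n = 0..Suc N. K * (D n * (L (q ^ n) + M (q ^ n))))"
    by (intro sum.cong) (auto simp: t_diff)
  also have "\<dots> = K * (D (Suc N) * L (q ^ Suc N))"
    using partial[of "Suc N"] by (simp only: sum_distrib_left[symmetric] order_refl)
  also have "\<dots> = 0" by (simp add: L_def P_def)
  finally have "(\<Sum>n = 0..Suc N. t (Suc N) n) = \<rho> * (\<Sum>n = 0..Suc N. t N n)"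
    by (simp only: sum_subtractf sum_distrib_left[symmetric]) simp
  \<comment> \<open>The factor $1 - q^{-N}q^N$ occurs here, so extending the sum for
    \<open>N\<close> by one term changes nothing.\<close>
  also have "t N (Suc N) = 0" using nz by (simp add: t_def qpoch_Suc)
  then have "(\<Sum>n = 0..Suc N. t N n) = (\<Sum>n = 0..N. t N n)" by simp
  also have "\<dots> = (1 - a) * (qpochs [a*q, a*q/(b*c)] q N / qpochs [a*q/b, a*q/c] q N)"
    unfolding t_def by (rule Suc.IH) (use Suc.prems in auto)
  also have "\<rho> * \<dots> = (1 - a) * (qpochs [a*q, a*q/(b*c)] q (Suc N) / qpochs [a*q/b, a*q/c] q (Suc N))"
    by (simp add: \<rho>_def qpoch_Suc P_def mult_ac)
  finally show ?case unfolding t_def .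
qed

section \<open>The second identity for generic square roots of y\<close>

text \<open>Reversing the order of the factors gives $1 - x/q^{i+1}$, from which $-x/q^{i+1}$ is
  taken out.\<close>

lemma qpoch_reflect:
  assumes "q \<noteq> 0" "x \<noteq> 0"
  shows "qpoch (x / q ^ N) q N = (- x) ^ N / (\<Prod>i<N. q ^ Suc i) * qpoch (q / x) q N"
proof -
  have "qpoch (x / q ^ N) q N = (\<Prod>i<N. 1 - x / q ^ N * q ^ (N - Suc i))"
    unfolding qpoch_def by (rule prod.nat_diff_reindex[symmetric])
  also have "\<dots> = (\<Prod>i<N. - x / q ^ Suc i * (1 - q / x * q ^ i))"
  proof (rule prod.cong)
    fix i assume "i \<in> {..<N}"
    then have "q ^ N = q ^ (N - Suc i) * q ^ Suc i" by (simp only: power_add[symmetric]) simp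
    then have "x / q ^ N * q ^ (N - Suc i) = x / q ^ Suc i" using assms by (simp add: divide_simps)
    then show "1 - x / q ^ N * q ^ (N - Suc i) = - x / q ^ Suc i * (1 - q / x * q ^ i)"
      using assms by (simp add: field_simps)
  qed simp
  also have "\<dots> = (- x) ^ N / (\<Prod>i<N. q ^ Suc i) * qpoch (q / x) q N"
    by (simp only: prod.distrib prod_dividef qpoch_def prod_constant card_lessThan)
  finally show ?thesis .
qed

text \<open>Here \<open>s\<close> is the square root of \<open>y\<close>. The hypothesis
  \<open>gen\<close> keeps $s^2$ off enough powers of \<open>q\<close> for both the first identity
  and the 6-phi-5 sum to apply.\<close>

lemma even_sum_closed_form_generic:
  fixes q s :: complex and N :: nat
  assumes N: "N > 0" and q0: "q \<noteq> 0" and s0: "s \<noteq> 0"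
    and root: "\<And>j. 1 \<le> j \<Longrightarrow> j \<le> N + 1 \<Longrightarrow> q ^ j \<noteq> 1"
    and gen: "\<And>j. \<bar>j\<bar> \<le> 4 * int N + 4 \<Longrightarrow> s\<^sup>2 * q powi j \<noteq> 1"
  shows "(\<Sum>n = 0..N div 2.
        (1 - s\<^sup>2 * q ^ (4 * n + 1)) * qpochs [s\<^sup>2, - s * q ^ (N + 1), q powi (- int N)] q (2 * n) * q ^ (2 * n) /
        ((1 - s\<^sup>2 * q) * qpochs [q\<^sup>2, - s * q powi (1 - int N), s\<^sup>2 * q ^ (2 + N)] q (2 * n)))
     = ((1 - q) * (1 + s)) / ((1 - q ^ (N + 1)) * (1 + s * q ^ N)) *
       (qpochs [s\<^sup>2 * q\<^sup>2, - q] q N / qpochs [q * s, - 1 / s] q N) * s powi (- int N)"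
proof -
  \<comment> \<open>This choice gives $qk/z = z$, so the factorials of \<open>z\<close> cancel on
    the left, and $k^2q^N/(yz)$ becomes \<open>w\<close>.\<close>
  define k z where "k = s\<^sup>2 * q" and "z = - (s * q)"
  define w v where "w = - s * q ^ (N + 1)" and "v = q powi (- int N)"
  have v: "v = 1 / q ^ N" by (simp add: v_def power_int_minus divide_simps)
  have nz: "k \<noteq> 0" "s\<^sup>2 \<noteq> 0" "z \<noteq> 0" using q0 s0 by (simp_all add: k_def z_def)
  have A: "s\<^sup>2 * q ^ j \<noteq> 1" if "j \<le> 4 * N + 4" for j
    using gen[of "int j"] that by simp
  \<comment> \<open>Squaring doubles the exponent, which is why \<open>gen\<close> reaches
    $4N+4$.\<close>
  have B: "s * x \<noteq> 1" "- s * x \<noteq> 1" if "x = q powi j" "\<bar>j\<bar> \<le> 2 * int N + 2" for x j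
  proof -
    have "s\<^sup>2 * x\<^sup>2 \<noteq> 1" using gen[of "2 * j"] that by (simp add: power_int_mult mult.commute[of 2])
    then have "(s * x)\<^sup>2 \<noteq> 1" by (simp add: power_mult_distrib)
    then show "s * x \<noteq> 1" "- s * x \<noteq> 1" by (auto simp: power2_eq_1_iff equation_minus_iff)
  qed
  have B1: "s * q ^ j \<noteq> 1" "- s * q ^ j \<noteq> 1" if "j \<le> 2 * N + 2" for j
    using B[of "q ^ j" "int j"] that by simp_all
  have B2: "- s * q powi l * q ^ i \<noteq> 1" if "\<bar>l + int i\<bar> \<le> 2 * int N + 2" for l i
    using B(2)[OF refl that] q0 by (simp add: power_int_add mult.assoc)
  have s1: "1 + s \<noteq> 0" "1 - s\<^sup>2 \<noteq> 0" "1 - k \<noteq> 0" "1 + s * q ^ N \<noteq> 0"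
    using B1(2)[of 0] A[of 0] A[of 1] B1(2)[of N]
    by (auto simp: k_def add_eq_0_iff)
  have s2: "1 + 1 / s \<noteq> 0" using s1(1) s0 by (simp add: field_simps add_eq_0_iff)
  have id: "q * k / s\<^sup>2 = q\<^sup>2" "q * k / z = - (s * q)" "s\<^sup>2 * z * q powi (1 - int N) / k = - s * q powi (1 - int N)"
    "k * q ^ (1 + N) = s\<^sup>2 * q ^ (2 + N)" "k\<^sup>2 * q ^ N / (s\<^sup>2 * z) = w"
    "k / s\<^sup>2 = q" "k / z = - s" "s\<^sup>2 * z * q powi (- int N) / k = - s / q ^ N" "k * q ^ N = s\<^sup>2 * q ^ (N + 1)"
    "k / (s\<^sup>2 * z) = - 1 / s" "s\<^sup>2 * q ^ (N + 1) / s\<^sup>2 = q ^ (N + 1)" "s\<^sup>2 * q ^ (N + 1) / z = - s * q ^ N"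
    "s\<^sup>2 * q ^ (N + 1) / (s\<^sup>2 * z) = - (q ^ N) / s"
    using q0 s0 by (simp_all add: k_def z_def w_def power_int_minus field_simps power2_eq_square)
  have q_poch: "qpoch q q n \<noteq> 0" if "n \<le> N + 1" for n
    using root that by (auto simp: qpoch_eq_0_iff simp flip: power_Suc)
  have q2_poch: "qpoch (q\<^sup>2) q (2*n) \<noteq> 0" if "n \<le> N div 2" for n
  proof (cases "n = 0")
    case False
    have "qpoch (q\<^sup>2) q i \<noteq> 0" if "i \<le> N" for i
      using q_poch[of "Suc i"] that by (simp add: qpoch_Suc_shift power2_eq_square)
    then show ?thesis using that by auto
  qed simp
  have s_poch: "qpoch (q * s) q n \<noteq> 0" "qpoch (- (s * q)) q n \<noteq> 0" if "n \<le> N" for n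
    using that B1[of "Suc i" for i] by (auto simp: qpoch_eq_0_iff mult_ac)
  have s0_poch: "qpoch s q n \<noteq> 0" "qpoch (- s) q n \<noteq> 0" if "n \<le> N" for n
    using that B1 by (auto simp: qpoch_eq_0_iff)
  have w_poch: "qpoch (- s * q powi (1 - int N)) q n \<noteq> 0" "qpoch (- s / q ^ N) q n \<noteq> 0" if "n \<le> N" for n
  proof -
    show "qpoch (- s * q powi (1 - int N)) q n \<noteq> 0"
      unfolding qpoch_eq_0_iff using that B2[of "1 - int N"] by auto
    have "- s / q ^ N = - s * q powi (- int N)" by (simp add: power_int_minus divide_simps)
    then show "qpoch (- s / q ^ N) q n \<noteq> 0"
      unfolding qpoch_eq_0_iff using that B2[of "- int N"] by auto
  qed
  have y_poch: "qpoch (s\<^sup>2 * q ^ (2 + N)) q n \<noteq> 0" "qpoch (s\<^sup>2 * q ^ (N + 1)) q n \<noteq> 0" if "n \<le> N" for n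
    using that A[of "2 + N + i" for i] A[of "N + 1 + i" for i] unfolding qpoch_eq_0_iff power_add[symmetric] mult.assoc
    by auto
  \<comment> \<open>Any root serves: \<open>qpoch_sqrt_ratio\<close> removes it again.\<close>
  define sk where "sk = csqrt k"
  have sk: "sk\<^sup>2 = k" by (simp add: sk_def)
  have sk_poch: "qpoch sk q n * qpoch (- sk) q n \<noteq> 0" if "n \<le> N" for n
  proof -
    have "sk * q ^ i \<noteq> 1 \<and> - sk * q ^ i \<noteq> 1" if "i < n" for i
    proof -
      have "(sk * q ^ i)\<^sup>2 = s\<^sup>2 * q ^ (2 * i + 1)"
        by (simp add: power_mult_distrib sk k_def power_even_eq)
      then have "(sk * q ^ i)\<^sup>2 \<noteq> 1" using A[of "2 * i + 1"] that \<open>n \<le> N\<close> by simp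
      then show ?thesis by (auto simp: power2_eq_1_iff equation_minus_iff)
    qed
    then show ?thesis by (auto simp: qpoch_eq_0_iff)
  qed
  have lhs: "qpochs [q * sk, - q * sk, s\<^sup>2, z, w, v] q (2 * n) * q ^ (2 * n) /
        qpochs [sk, - sk, q\<^sup>2, - (s * q), - s * q powi (1 - int N), s\<^sup>2 * q ^ (2 + N)] q (2 * n)
     = (1 - s\<^sup>2 * q ^ (4 * n + 1)) * qpochs [s\<^sup>2, w, v] q (2 * n) * q ^ (2 * n) /
        ((1 - s\<^sup>2 * q) * qpochs [q\<^sup>2, - s * q powi (1 - int N), s\<^sup>2 * q ^ (2 + N)] q (2 * n))"
    (is "?l = ?r") if "n \<le> N div 2" for n
  proof -
    have n: "2 * n \<le> N" using that by simp
    have "?l = (qpoch (q * sk) q (2*n) * qpoch (- (q * sk)) q (2*n) / (qpoch sk q (2*n) * qpoch (- sk) q (2*n)))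
       * (qpochs [s\<^sup>2, w, v] q (2 * n) * q ^ (2 * n) / qpochs [q\<^sup>2, - s * q powi (1 - int N), s\<^sup>2 * q ^ (2 + N)] q (2 * n))"
      using s_poch(2)[OF n] by (simp add: z_def mult.assoc)
    also have "\<dots> = (1 - k * q ^ (2*(2*n))) / (1 - k)
       * (qpochs [s\<^sup>2, w, v] q (2 * n) * q ^ (2 * n) / qpochs [q\<^sup>2, - s * q powi (1 - int N), s\<^sup>2 * q ^ (2 + N)] q (2 * n))"
      by (subst qpoch_sqrt_ratio[OF sk s1(3) sk_poch[OF n]]) simp
    also have "\<dots> = ?r" by (simp add: k_def mult_ac)
    finally show ?thesis .
  qed
  have main: "(\<Sum>n = 0..N div 2. (1 - s\<^sup>2 * q ^ (4 * n + 1)) * qpochs [s\<^sup>2, w, v] q (2 * n) * q ^ (2 * n) /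
        ((1 - s\<^sup>2 * q) * qpochs [q\<^sup>2, - s * q powi (1 - int N), s\<^sup>2 * q ^ (2 + N)] q (2 * n)))
     = ((1 - q) * (1 + s) * (1 - s\<^sup>2 * q ^ (N + 1)) * (1 + q ^ N / s)) /
       ((1 - k) * (1 + 1 / s) * (1 - q ^ (N + 1)) * (1 + s * q ^ N)) *
       (\<Sum>n = 0..N. qpochs [s\<^sup>2, z, w, v] q n / qpochs [q, - s, s\<^sup>2 * q ^ (N + 1), - s / q ^ N] q n * (- 1) ^ n)"
  proof -
    have "qpochs [sk, - sk, q * k / s\<^sup>2, q * k / z, s\<^sup>2 * z * q powi (1 - int N) / k, k * q ^ (1 + N)] q (2 * n) \<noteq> 0"
      if "n \<le> N div 2" for n
    proof -
      have n: "2 * n \<le> N" using that by simp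
      show ?thesis unfolding id
        using sk_poch[OF n] q2_poch[OF that] s_poch[OF n] w_poch[OF n] y_poch[OF n] by simp
    qed
    moreover have "(1 - k) * (1 - k / (s\<^sup>2 * z)) * (1 - k * q ^ N / s\<^sup>2) * (1 - k * q ^ N / z) \<noteq> 0"
      unfolding id using s1 s2 root[of "N + 1"] by simp
    moreover have "qpochs [k / s\<^sup>2, k / z, k * q ^ N, s\<^sup>2 * z * q powi (- int N) / k] q n \<noteq> 0" if "n \<le> N" for n
      unfolding id using that q_poch s0_poch y_poch w_poch by simp
    ultimately have *: "(\<Sum>n = 0..N div 2.
        qpochs [q * sk, - q * sk, s\<^sup>2, z, k\<^sup>2 * q ^ N / (s\<^sup>2 * z), q powi (- int N)] q (2 * n) * q ^ (2 * n) /
        qpochs [sk, - sk, q * k / s\<^sup>2, q * k / z, s\<^sup>2 * z * q powi (1 - int N) / k, k * q ^ (1 + N)] q (2 * n))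
     = ((1 - k / s\<^sup>2) * (1 - k / z) * (1 - k * q ^ N) * (1 - k * q ^ N / (s\<^sup>2 * z))) /
       ((1 - k) * (1 - k / (s\<^sup>2 * z)) * (1 - k * q ^ N / s\<^sup>2) * (1 - k * q ^ N / z)) *
       (\<Sum>n = 0..N.
          qpochs [s\<^sup>2, z, k\<^sup>2 * q ^ N / (s\<^sup>2 * z), q powi (- int N)] q n /
          qpochs [k / s\<^sup>2, k / z, k * q ^ N, s\<^sup>2 * z * q powi (- int N) / k] q n * (- 1) ^ n)"
      by (intro even_well_poised_sum[OF N q0 nz sk])
    have "(\<Sum>n = 0..N div 2. (1 - s\<^sup>2 * q ^ (4 * n + 1)) * qpochs [s\<^sup>2, w, v] q (2 * n) * q ^ (2 * n) /
        ((1 - s\<^sup>2 * q) * qpochs [q\<^sup>2, - s * q powi (1 - int N), s\<^sup>2 * q ^ (2 + N)] q (2 * n)))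
      = (\<Sum>n = 0..N div 2. qpochs [q * sk, - q * sk, s\<^sup>2, z, w, v] q (2 * n) * q ^ (2 * n) /
        qpochs [sk, - sk, q\<^sup>2, - (s * q), - s * q powi (1 - int N), s\<^sup>2 * q ^ (2 + N)] q (2 * n))"
      by (rule sum.cong[OF refl], rule lhs[symmetric]) simp
    also note *[unfolded id, folded v_def]
    finally show ?thesis by simp
  qed
  have phi: "(\<Sum>n = 0..N. qpochs [s\<^sup>2, z, w, v] q n / qpochs [q, - s, s\<^sup>2 * q ^ (N + 1), - s / q ^ N] q n * (- 1) ^ n)
     = qpochs [s\<^sup>2 * q, - 1 / q ^ N] q N / qpochs [q * s, - s / q ^ N] q N"
  proof -
    have w0: "w \<noteq> 0" using q0 s0 by (simp add: w_def)
    have arg: "s\<^sup>2 * q ^ (N + 1) / (s * w) = - 1" "s\<^sup>2 * q / s = q * s" "s\<^sup>2 * q / w = - s / q ^ N"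
      "s\<^sup>2 * q / (s * w) = - 1 / q ^ N"
      using q0 s0 by (simp_all add: w_def field_simps power2_eq_square)
    have c1: "q ^ j \<noteq> 1 \<and> s\<^sup>2 * q ^ j / s \<noteq> 1 \<and> s\<^sup>2 * q ^ j / w \<noteq> 1" if "1 \<le> j" "j \<le> N" for j
    proof -
      have "s\<^sup>2 * q ^ j / w = - s * q powi (int j - int (N + 1))"
        using q0 s0 unfolding power_int_diff[OF disjI1[OF q0]] power_int_of_nat
        by (simp add: w_def field_simps power2_eq_square)
      moreover have "s\<^sup>2 * q ^ j / s = s * q ^ j" using s0 by (simp add: power2_eq_square)
      ultimately show ?thesis using root[of j] B1[of j] B(2)[of _ "int j - int (N + 1)"] that by auto
    qed
    have c2: "s\<^sup>2 * q ^ j \<noteq> 1" if "1 \<le> j" "j \<le> 2 * N" for j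
      using A that by simp
    \<comment> \<open>The quotient $(-qs;q)_n/(-s;q)_n$ is half of a very-well-poised factor.
      Completing it by $(qs;q)_n/(s;q)_n$ leaves $(s;q)_n/(qs;q)_n$, the contribution of the
      parameter $b = s$.\<close>
    have t: "qpochs [s\<^sup>2, z, w, v] q n / qpochs [q, - s, s\<^sup>2 * q ^ (N + 1), - s / q ^ N] q n * (- 1) ^ n
       = (1 - s\<^sup>2 * q ^ (2*n)) * qpochs [s\<^sup>2, s, w, 1 / q ^ N] q n * (- 1) ^ n
            / qpochs [q, q * s, - s / q ^ N, s\<^sup>2 * q ^ (N+1)] q n / (1 - s\<^sup>2)" if "n \<le> N" for n
    proof -
      have "qpoch (q * s) q n * qpoch z q n / (qpoch s q n * qpoch (- s) q n) = (1 - s\<^sup>2 * q ^ (2*n)) / (1 - s\<^sup>2)"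
        using qpoch_sqrt_ratio[of s "s\<^sup>2" q n] s1(2) s0_poch[OF that] by (simp add: z_def mult_ac)
      then have "qpoch z q n / qpoch (- s) q n = (1 - s\<^sup>2 * q ^ (2*n)) / (1 - s\<^sup>2) * (qpoch s q n / qpoch (q * s) q n)"
        using s0_poch[OF that] s_poch[OF that] s1(2) by (simp add: field_simps)
      then have "qpoch z q n / qpoch (- s) q n * Z = (1 - s\<^sup>2 * q ^ (2*n)) / (1 - s\<^sup>2) * (qpoch s q n / qpoch (q * s) q n) * Z" for Z
        by simp
      from this[of "qpochs [s\<^sup>2, w, v] q n / qpochs [q, s\<^sup>2 * q ^ (N + 1), - s / q ^ N] q n * (- 1) ^ n"]
      show ?thesis by (simp add: v mult_ac)
    qed
    have "(\<Sum>n = 0..N. qpochs [s\<^sup>2, z, w, v] q n / qpochs [q, - s, s\<^sup>2 * q ^ (N + 1), - s / q ^ N] q n * (- 1) ^ n)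
      = (\<Sum>n = 0..N. (1 - s\<^sup>2 * q ^ (2*n)) * qpochs [s\<^sup>2, s, w, 1 / q ^ N] q n * (- 1) ^ n
            / qpochs [q, q * s, - s / q ^ N, s\<^sup>2 * q ^ (N+1)] q n) / (1 - s\<^sup>2)"
      unfolding sum_divide_distrib by (rule sum.cong[OF refl], rule t) simp
    also have "\<dots> = qpochs [s\<^sup>2 * q, - 1 / q ^ N] q N / qpochs [q * s, - s / q ^ N] q N"
      using terminating_6phi5[where N = N, OF nz(2) s0 w0 q0 c1 c2, unfolded arg] s1(2) by simp
    finally show ?thesis .
  qed
  \<comment> \<open>This power of \<open>q\<close> arises in the reflections at $x = -1$ and at $x =
    -s$ and cancels in their quotient, which leaves $s^{-N}$, the source of $y^{-N/2}$.\<close>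
  define C where "C = (\<Prod>i<N. q ^ Suc i)"
  have C0: "C \<noteq> 0" using q0 by (simp add: C_def)
  have r1: "qpoch (- 1 / q ^ N) q N = 1 / C * qpoch (- q) q N"
    using qpoch_reflect[OF q0, of "-1" N] by (simp add: C_def)
  have r2: "qpoch (- s / q ^ N) q N = s ^ N / C * qpoch (- q / s) q N"
    using qpoch_reflect[OF q0, of "-s" N] s0 by (simp add: C_def)
  \<comment> \<open>Both sides are $(-1/s;q)_{N+1}$, with the first or the last factor split off;
    \<open>r4\<close> compares two forms of $(s^2q;q)_{N+1}$ likewise.\<close>
  have r3: "(1 + 1 / s) * qpoch (- q / s) q N = qpoch (- 1 / s) q N * (1 + q ^ N / s)"
    using qpoch_Suc[of "-1/s" q N] qpoch_Suc_shift[of "-1/s" q N] by simp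
  have r4: "qpoch (s\<^sup>2 * q) q N * (1 - s\<^sup>2 * q ^ (N + 1)) = (1 - k) * qpoch (s\<^sup>2 * q\<^sup>2) q N"
    using qpoch_Suc[of "s\<^sup>2 * q" q N] qpoch_Suc_shift[of "s\<^sup>2 * q" q N]
    by (simp add: k_def power2_eq_square mult_ac)
  have qs: "qpoch (- q / s) q N \<noteq> 0" using w_poch(2)[of N] unfolding r2 by simp
  have nn: "qpoch (- 1 / s) q N \<noteq> 0" "1 + q ^ N / s \<noteq> 0"
    using r3 qs s2 by (metis mult_eq_0_iff)+
  have r5: "qpoch (s\<^sup>2 * q) q N * (1 - s\<^sup>2 * q ^ (N + 1)) / (1 - k) = qpoch (s\<^sup>2 * q\<^sup>2) q N"
    unfolding r4 using s1(3) by simp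
  have r6: "(1 + q ^ N / s) / ((1 + 1 / s) * qpoch (- q / s) q N) = 1 / qpoch (- 1 / s) q N"
    unfolding r3 using nn by simp
  have r7: "qpoch (- 1 / q ^ N) q N / qpoch (- s / q ^ N) q N = qpoch (- q) q N * s powi (- int N) / qpoch (- q / s) q N"
    unfolding r1 r2 using C0 s0 by (simp add: power_int_minus divide_simps)
  have "((1 - q) * (1 + s) * (1 - s\<^sup>2 * q ^ (N + 1)) * (1 + q ^ N / s)) /
       ((1 - k) * (1 + 1 / s) * (1 - q ^ (N + 1)) * (1 + s * q ^ N)) *
       (qpochs [s\<^sup>2 * q, - 1 / q ^ N] q N / qpochs [q * s, - s / q ^ N] q N)
     = (1 - q) * (1 + s) / ((1 - q ^ (N + 1)) * (1 + s * q ^ N)) / qpoch (q * s) q N *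
       (qpoch (s\<^sup>2 * q) q N * (1 - s\<^sup>2 * q ^ (N + 1)) / (1 - k)) * ((1 + q ^ N / s) / (1 + 1 / s)) *
       (qpoch (- 1 / q ^ N) q N / qpoch (- s / q ^ N) q N)"
    by (simp only: qpochs_Cons qpochs_Nil times_divide_eq_left times_divide_eq_right divide_divide_eq_left mult_ac mult_1_right mult_1_left)
  also have "\<dots> = (1 - q) * (1 + s) / ((1 - q ^ (N + 1)) * (1 + s * q ^ N)) / qpoch (q * s) q N *
       qpoch (s\<^sup>2 * q\<^sup>2) q N * ((1 + q ^ N / s) / ((1 + 1 / s) * qpoch (- q / s) q N)) *
       (qpoch (- q) q N * s powi (- int N))"
    unfolding r5 r7 by (simp only: times_divide_eq_left times_divide_eq_right divide_divide_eq_left mult_ac)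
  also have "\<dots> = ((1 - q) * (1 + s)) / ((1 - q ^ (N + 1)) * (1 + s * q ^ N)) *
       (qpochs [s\<^sup>2 * q\<^sup>2, - q] q N / qpochs [q * s, - 1 / s] q N) * s powi (- int N)"
    unfolding r6 by (simp only: qpochs_Cons qpochs_Nil times_divide_eq_left times_divide_eq_right divide_divide_eq_left mult_ac mult_1_right mult_1_left)
  finally show ?thesis unfolding w_def[symmetric] v_def[symmetric] main phi .
qed

section \<open>Removal of the genericity assumptions by continuity\<close>

text \<open>A punctured neighbourhood of \<open>x\<close> avoids \<open>B\<close>, so both functions
  have the same limit at \<open>x\<close>.\<close>

lemma isCont_eq_off_finite:
  fixes f g :: "complex \<Rightarrow> complex"
  assumes "isCont f x" "isCont g x" "finite B" "\<And>t. t \<notin> B \<Longrightarrow> f t = g t"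
  shows "f x = g x"
proof -
  have "\<forall>\<^sub>F t in at x. t \<notin> B"
    unfolding eventually_at_topological
    by (rule exI[of _ "- (B - {x})"]) (use assms(3) in \<open>auto intro!: open_Compl finite_imp_closed simp del: Compl_Diff_eq\<close>)
  then have "\<forall>\<^sub>F t in at x. f t = g t" by eventually_elim (rule assms(4))
  then have "(g \<longlongrightarrow> f x) (at x)"
    using assms(1) by (metis isCont_def tendsto_cong)
  then show ?thesis using assms(2) by (metis isCont_def LIM_unique)
qed

lemma continuous_qpoch [continuous_intros]:
  "continuous F f \<Longrightarrow> continuous F (\<lambda>t. qpoch (f t) q n)"
  unfolding qpoch_def by (intro continuous_intros)

text \<open>With \<open>q\<close> fixed, both sides are functions of the square root alone.
  Nonvanishing of the displayed denominators makes them continuous at \<open>s\<close>, and the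
  generic case gives equality off a finite set.\<close>

lemma even_sum_closed_form:
  fixes q s :: complex and N :: nat
  assumes N: "N > 0" and q0: "q \<noteq> 0" and s0: "s \<noteq> 0"
    and d1: "\<And>n. n \<le> N div 2 \<Longrightarrow>
        (1 - s\<^sup>2 * q) * qpochs [q\<^sup>2, - s * q powi (1 - int N), s\<^sup>2 * q ^ (2 + N)] q (2 * n) \<noteq> 0"
    and d2: "(1 - q ^ (N + 1)) * (1 + s * q ^ N) \<noteq> 0"
    and d3: "qpochs [q * s, - 1 / s] q N \<noteq> 0"
  shows "(\<Sum>n = 0..N div 2.
        (1 - s\<^sup>2 * q ^ (4 * n + 1)) * qpochs [s\<^sup>2, - s * q ^ (N + 1), q powi (- int N)] q (2 * n) * q ^ (2 * n) /
        ((1 - s\<^sup>2 * q) * qpochs [q\<^sup>2, - s * q powi (1 - int N), s\<^sup>2 * q ^ (2 + N)] q (2 * n)))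
     = ((1 - q) * (1 + s)) / ((1 - q ^ (N + 1)) * (1 + s * q ^ N)) *
       (qpochs [s\<^sup>2 * q\<^sup>2, - q] q N / qpochs [q * s, - 1 / s] q N) * s powi (- int N)"
proof -
  define f where "f s = (\<Sum>n = 0..N div 2.
        (1 - s\<^sup>2 * q ^ (4 * n + 1)) * qpochs [s\<^sup>2, - s * q ^ (N + 1), q powi (- int N)] q (2 * n) * q ^ (2 * n) /
        ((1 - s\<^sup>2 * q) * qpochs [q\<^sup>2, - s * q powi (1 - int N), s\<^sup>2 * q ^ (2 + N)] q (2 * n)))" for s
  define g where "g s = ((1 - q) * (1 + s)) / ((1 - q ^ (N + 1)) * (1 + s * q ^ N)) *
       (qpochs [s\<^sup>2 * q\<^sup>2, - q] q N / qpochs [q * s, - 1 / s] q N) * s powi (- int N)" for s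
  define B where "B = insert 0 (\<Union>j \<in> {- (4 * int N + 4)..4 * int N + 4}. {t. t\<^sup>2 = q powi (- j)})"
  \<comment> \<open>This condition does not involve \<open>s\<close>, so varying \<open>s\<close>
    cannot secure it. The extreme cases follow from $q^{N+1} \<noteq> 1$; for $2 \<le> j \<le> N$
    the factor $1 - q^j$ divides $(q^2;q)_{2\<lfloor>N/2\<rfloor>}$, since $N \<le>
    2\<lfloor>N/2\<rfloor> + 1$.\<close>
  have root: "q ^ j \<noteq> 1" if "1 \<le> j" "j \<le> N + 1" for j
  proof -
    from that consider "j = 1" | "j = N + 1" | "2 \<le> j" "j \<le> N" by linarith
    then show ?thesis
    proof cases
      case 1
      with d2 show ?thesis by auto
    next
      case 2
      with d2 show ?thesis by auto
    next
      case 3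
      have "qpoch (q\<^sup>2) q (2 * (N div 2)) \<noteq> 0" using d1[of "N div 2"] by simp
      moreover have "j - 2 < 2 * (N div 2)" using 3 by presburger
      ultimately have "q\<^sup>2 * q ^ (j - 2) \<noteq> 1" unfolding qpoch_eq_0_iff by blast
      then show ?thesis using 3 by (simp only: power_add[symmetric] le_add_diff_inverse) simp
    qed
  qed
  have "f s = g s"
  proof (rule isCont_eq_off_finite[where f = f and g = g])
    show "finite B" unfolding B_def by (auto intro!: finite_nth_roots)
    show "f t = g t" if "t \<notin> B" for t
      unfolding f_def g_def
    proof (rule even_sum_closed_form_generic[OF N q0])
      show "q ^ j \<noteq> 1" if "1 \<le> j" "j \<le> N + 1" for j by (rule root[OF that])
      show "t \<noteq> 0" using that by (auto simp: B_def)
      fix j :: int assume j: "\<bar>j\<bar> \<le> 4 * int N + 4"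
      then have "j \<in> {- (4 * int N + 4)..4 * int N + 4}" by auto
      then have "t\<^sup>2 \<noteq> q powi (- j)" using that unfolding B_def by blast
      then show "t\<^sup>2 * q powi j \<noteq> 1" using q0 by (auto simp: power_int_minus field_simps)
    qed
    show "isCont f s" unfolding f_def qpochs_Cons qpochs_Nil
      using d1 by (intro continuous_intros) auto
    show "isCont g s" unfolding g_def qpochs_Cons qpochs_Nil
      using d2 d3 s0 by (intro continuous_intros) auto
  qed
  then show ?thesis unfolding f_def g_def .
qed

theorem corollary3:
  fixes q k y z sk sy :: complex and N :: nat
  assumes "N > 0"
    and "q \<noteq> 0" and "k \<noteq> 0" and "y \<noteq> 0" and "z \<noteq> 0"
    and "sk\<^sup>2 = k" and "sy\<^sup>2 = y"
  shows
   "((\<forall>n \<le> N div 2.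
        qpochs [sk, - sk, q * k / y, q * k / z, y * z * q powi (1 - int N) / k, k * q ^ (1 + N)] q (2 * n) \<noteq> 0) \<and>
     (1 - k) * (1 - k / (y * z)) * (1 - k * q ^ N / y) * (1 - k * q ^ N / z) \<noteq> 0 \<and>
     (\<forall>n \<le> N.
        qpochs [k / y, k / z, k * q ^ N, y * z * q powi (- int N) / k] q n \<noteq> 0)
     \<longrightarrow>
     (\<Sum>n = 0..N div 2.
        qpochs [q * sk, - q * sk, y, z, k\<^sup>2 * q ^ N / (y * z), q powi (- int N)] q (2 * n) * q ^ (2 * n) /
        qpochs [sk, - sk, q * k / y, q * k / z, y * z * q powi (1 - int N) / k, k * q ^ (1 + N)] q (2 * n))
     = ((1 - k / y) * (1 - k / z) * (1 - k * q ^ N) * (1 - k * q ^ N / (y * z))) /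
       ((1 - k) * (1 - k / (y * z)) * (1 - k * q ^ N / y) * (1 - k * q ^ N / z)) *
       (\<Sum>n = 0..N.
          qpochs [y, z, k\<^sup>2 * q ^ N / (y * z), q powi (- int N)] q n /
          qpochs [k / y, k / z, k * q ^ N, y * z * q powi (- int N) / k] q n * (- 1) ^ n))
    \<and>
    ((\<forall>n \<le> N div 2.
        (1 - y * q) * qpochs [q\<^sup>2, - sy * q powi (1 - int N), y * q ^ (2 + N)] q (2 * n) \<noteq> 0) \<and>
     (1 - q ^ (N + 1)) * (1 + sy * q ^ N) \<noteq> 0 \<and>
     qpochs [q * sy, - 1 / sy] q N \<noteq> 0
     \<longrightarrow>
     (\<Sum>n = 0..N div 2.
        (1 - y * q ^ (4 * n + 1)) * qpochs [y, - sy * q ^ (N + 1), q powi (- int N)] q (2 * n) * q ^ (2 * n) /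
        ((1 - y * q) * qpochs [q\<^sup>2, - sy * q powi (1 - int N), y * q ^ (2 + N)] q (2 * n)))
     = ((1 - q) * (1 + sy)) / ((1 - q ^ (N + 1)) * (1 + sy * q ^ N)) *
       (qpochs [y * q\<^sup>2, - q] q N / qpochs [q * sy, - 1 / sy] q N) * sy powi (- int N))"
  using assms even_well_poised_sum[of N q k y z sk] even_sum_closed_form[of N q sy]
  by auto
end
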